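(* There is an absolute constant $C>0$ such that the following holds. Let $g(x)\in\mathbb{Z}[x]$ be a nonconstant monic irreducible polynomial of degree $s\ge 1$, let $p$ be a sufficiently large prime number (how large may depend on $g$), let $\mathbb{Z}_p$ be the finite field of integers modulo $p$, and let $h(x)=g(x) \bmod p\in\mathbb{Z}_p[x]$. Suppose that $\gcd(h(x),x)=1$, that $\deg h(x)=s$, and that every monic irreducible polynomial over $\mathbb{Z}_p$ of degree at most $s$, other than $x$, is equally likely to be a factor of $h(x)$ over $\mathbb{Z}_p$. Then the probability that $h(x)$ is irreducible over $\mathbb{Z}_p$ is at least $$1-\frac{s+1}{p-1}-C\,\frac{s^{2}}{(p-1)^{2}},$$ that is, at least $1-\frac{s+1}{p-1}+\mathcal{O}\!\left(\frac{s^{2}}{(p-1)^{2}}\right)$.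
   Context: The polynomial $h$ is obtained by reducing each coefficient of $g$ modulo $p$. The "equally likely" hypothesis is the probability model in which the probability is computed: an irreducible factor of $h$ is regarded as drawn uniformly at random from the finite set $\mathcal{I}_{p,s}$ of all monic irreducible polynomials in $\mathbb{Z}_p[x]$ of degree at most $s$ other than $x$. Since $h$ is monic of degree $s$, $h$ is irreducible exactly when it has an irreducible factor of degree $s$. The probability that $h$ is irreducible is accordingly the probability that the drawn element of $\mathcal{I}_{p,s}$ has degree $s$, i.e. the ratio $$\frac{\#\{q\in\mathcal{I}_{p,s}:\deg q=s\}}{\#\,\mathcal{I}_{p,s}}.$$ *)

theory Defs
  imports
    "HOL-Algebra.Polynomial_Divisibility"
    "HOL-Number_Theory.Residues"
    "HOL-Computational_Algebra.Polynomial_Factorial"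
    "HOL-Probability.Probability_Mass_Function"
begin

text \<open>
  The field of integers modulo \<^term>\<open>p\<close> is \<^term>\<open>residue_ring (int p)\<close>, with carrier
  \<open>{0..p - 1}\<close>. Elements of \<^term>\<open>poly_ring R\<close> are coefficient lists, leading coefficient first.
\<close>

definition reduce_mod :: "nat \<Rightarrow> int poly \<Rightarrow> int list" where
  "reduce_mod p g =
     ring.normalize (residue_ring (int p)) (map (\<lambda>c. c mod int p) (rev (coeffs g)))"

definition monic_irreducibles :: "nat \<Rightarrow> nat \<Rightarrow> int list set" where
  "monic_irreducibles p s =
     {q \<in> carrier (poly_ring (residue_ring (int p))).
        ring_irreducible\<^bsub>poly_ring (residue_ring (int p))\<^esub> q \<and>
        Polynomials.lead_coeff q = \<one>\<^bsub>residue_ring (int p)\<^esub> \<and>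
        Polynomials.degree q \<le> s \<and> q \<noteq> X\<^bsub>residue_ring (int p)\<^esub>}"

text \<open>\<open>D\<close> is the distribution of the irreducible factor in the probability model.\<close>

definition equally_likely_factor :: "nat \<Rightarrow> nat \<Rightarrow> int list pmf \<Rightarrow> bool" where
  "equally_likely_factor p s D \<longleftrightarrow>
     set_pmf D \<subseteq> monic_irreducibles p s \<and>
     (\<forall>q \<in> monic_irreducibles p s. \<forall>r \<in> monic_irreducibles p s. pmf D q = pmf D r)"

text \<open>
  A monic polynomial of degree \<open>s\<close> is irreducible iff it has an irreducible factor of
  degree \<open>s\<close>; accordingly, in the model, its probability of being irreducible is the probability
  that the factor drawn according to \<open>D\<close> has degree \<open>s\<close>.
\<close>

definition prob_irreducible :: "int list pmf \<Rightarrow> nat \<Rightarrow> real" where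
  "prob_irreducible D s = measure_pmf.prob D {q. Polynomials.degree q = s}"


text \<open>Sanity checks: the reduction is coefficientwise, the irreducibility of \<open>h\<close> is the existence
  of an irreducible factor of degree \<open>s\<close>, and the model exists, is unique, and yields a ratio of
  cardinalities.\<close>

lemma residue_field:
  assumes "Factorial_Ring.prime p"
  shows "field (residue_ring (int p))"
proof -
  interpret residues_prime p "residue_ring (int p)"
    using assms by unfold_locales auto
  show ?thesis by (rule is_field)
qed

lemma reduce_mod_coeff:
  assumes "Factorial_Ring.prime p"
  shows "reduce_mod p g \<in> carrier (poly_ring (residue_ring (int p)))"
    and "ring.coeff (residue_ring (int p)) (reduce_mod p g) i = Polynomial.coeff g i mod int p"
proof -
  interpret field "residue_ring (int p)" by (rule residue_field[OF assms])
  let ?l = "map (\<lambda>c. c mod int p) (rev (coeffs g))"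
  have "p > 0" using assms prime_gt_0_nat by blast
  hence sub: "set ?l \<subseteq> carrier (residue_ring (int p))"
    by (auto simp: residue_ring_def)
  show "reduce_mod p g \<in> carrier (poly_ring (residue_ring (int p)))"
    unfolding reduce_mod_def univ_poly_carrier[symmetric]
    by (rule normalize_gives_polynomial[OF sub])
  have z: "\<zero>\<^bsub>residue_ring (int p)\<^esub> = 0" by (simp add: residue_ring_def)
  have "coeff ?l i = Polynomial.coeff g i mod int p"
  proof (cases "i < length ?l")
    case True
    hence i: "i < length (coeffs g)" by simp
    have "coeff ?l i = ?l ! (length ?l - 1 - i)"
      using True by (rule coeff_nth)
    also have "\<dots> = coeffs g ! i mod int p"
      using i by (simp del: rev_map add: rev_map[symmetric] rev_nth Suc_diff_Suc)
    also have "coeffs g ! i = Polynomial.coeff g i"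
      using i nth_default_nth[OF i] nth_default_coeffs_eq[of g] by metis
    finally show ?thesis .
  next
    case False
    hence "Polynomial.coeff g i = 0"
      using nth_default_coeffs_eq[of g] by (metis length_map length_rev nth_default_beyond not_less)
    then show ?thesis using False coeff_length[of ?l i] by (simp add: z)
  qed
  thus "coeff (reduce_mod p g) i = Polynomial.coeff g i mod int p"
    unfolding reduce_mod_def using normalize_coeff by metis
qed

lemma irreducible_iff_factor_of_full_degree:
  fixes p s :: nat
  defines "R \<equiv> residue_ring (int p)"
  assumes p: "Factorial_Ring.prime p"
    and h: "h \<in> carrier (poly_ring R)" "Polynomials.lead_coeff h = \<one>\<^bsub>R\<^esub>"
      "Polynomials.degree h = s" "s \<ge> 1"
    and gcd: "\<one>\<^bsub>poly_ring R\<^esub> gcdof\<^bsub>poly_ring R\<^esub> h X\<^bsub>R\<^esub>"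
  shows "ring_irreducible\<^bsub>poly_ring R\<^esub> h \<longleftrightarrow>
    (\<exists>q \<in> monic_irreducibles p s. q divides\<^bsub>poly_ring R\<^esub> h \<and> Polynomials.degree q = s)"
proof
  interpret field R unfolding R_def by (rule residue_field[OF p])
  interpret UP: domain "poly_ring R" by (rule univ_poly_is_domain[OF carrier_is_subring])
  {
    assume irr: "ring_irreducible\<^bsub>poly_ring R\<^esub> h"
    have "h \<noteq> X\<^bsub>R\<^esub>"
    proof
      assume "h = X\<^bsub>R\<^esub>"
      hence "h divides\<^bsub>poly_ring R\<^esub> \<one>\<^bsub>poly_ring R\<^esub>"
        using gcd h(1) UP.divides_refl[OF h(1)] unfolding isgcd_def by blast
      hence "h \<in> Units (poly_ring R)" using h(1) UP.divides_one by blast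
      thus False using irr by (simp add: ring_irreducible_def Divisibility.irreducible_def)
    qed
    hence "h \<in> monic_irreducibles p s"
      using irr h by (simp add: monic_irreducibles_def R_def)
    thus "\<exists>q \<in> monic_irreducibles p s. q divides\<^bsub>poly_ring R\<^esub> h \<and> Polynomials.degree q = s"
      using UP.divides_refl[OF h(1)] h(3) by blast
  }
  assume "\<exists>q \<in> monic_irreducibles p s. q divides\<^bsub>poly_ring R\<^esub> h \<and> Polynomials.degree q = s"
  then obtain q c where q: "q \<in> monic_irreducibles p s" "Polynomials.degree q = s"
    and c: "c \<in> carrier (poly_ring R)" "h = q \<otimes>\<^bsub>poly_ring R\<^esub> c"
    unfolding factor_def by blast
  have qc: "q \<in> carrier (poly_ring R)" and qi: "ring_irreducible\<^bsub>poly_ring R\<^esub> q"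
    and ql: "Polynomials.lead_coeff q = \<one>\<^bsub>R\<^esub>"
    using q(1) by (auto simp: monic_irreducibles_def R_def)
  have pol: "polynomial\<^bsub>R\<^esub> (carrier R) q" "polynomial\<^bsub>R\<^esub> (carrier R) c"
    using qc c(1) by (simp_all add: univ_poly_carrier)
  have hm: "h = poly_mult q c" using c(2) by (simp add: univ_poly_mult)
  have ne: "q \<noteq> []" "c \<noteq> []"
    using q(2) h(3,4) poly_mult_degree_eq[OF carrier_is_subring pol] by (auto simp: hm)
  have "Polynomials.degree c = 0"
    using poly_mult_degree_eq[OF carrier_is_subring pol] ne q(2) h(3) by (simp add: hm)
  then obtain k where k: "c = [k]" using ne(2) by (cases c) auto
  have "k \<in> carrier R" using pol(2) k by (simp add: polynomial_def)
  moreover have "\<one>\<^bsub>R\<^esub> = \<one>\<^bsub>R\<^esub> \<otimes>\<^bsub>R\<^esub> k"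
    using poly_mult_lead_coeff[OF carrier_is_subring pol ne] h(2) ql k by (simp add: hm)
  ultimately have "c = \<one>\<^bsub>poly_ring R\<^esub>" using k by (simp add: univ_poly_one)
  hence "h = q" using c(2) qc by simp
  thus "ring_irreducible\<^bsub>poly_ring R\<^esub> h" using qi by simp
qed

lemma finite_monic_irreducibles:
  assumes "Factorial_Ring.prime p"
  shows "finite (monic_irreducibles p s)"
proof (rule finite_subset)
  show "monic_irreducibles p s \<subseteq> {l. set l \<subseteq> carrier (residue_ring (int p)) \<and> length l \<le> Suc s}"
    by (auto simp: monic_irreducibles_def univ_poly_carrier[symmetric] polynomial_def)
  show "finite {l. set l \<subseteq> carrier (residue_ring (int p)) \<and> length l \<le> Suc s}"
    by (rule finite_lists_length_le) (simp add: residue_ring_def)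
qed

lemma monic_irreducibles_nonempty:
  assumes "Factorial_Ring.prime p" "s \<ge> 1"
  shows "monic_irreducibles p s \<noteq> {}"
proof -
  interpret field "residue_ring (int p)" by (rule residue_field[OF assms(1)])
  have "p > 1" using assms prime_gt_1_nat by blast
  hence c: "[1, 1] \<in> carrier (poly_ring (residue_ring (int p)))"
    by (auto simp: univ_poly_carrier[symmetric] polynomial_def residue_ring_def)
  hence "pirreducible\<^bsub>residue_ring (int p)\<^esub> (carrier (residue_ring (int p))) [1, 1]"
    by (intro degree_one_imp_pirreducible carrier_is_subfield) auto
  hence "[1, 1] \<in> monic_irreducibles p s"
    using c assms(2) by (auto simp: monic_irreducibles_def var_def residue_ring_def)
  thus ?thesis by blast
qed

lemma equally_likely_factor_iff:
  assumes "Factorial_Ring.prime p" "s \<ge> 1"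
  shows "equally_likely_factor p s D \<longleftrightarrow> D = pmf_of_set (monic_irreducibles p s)"
proof
  let ?I = "monic_irreducibles p s"
  note fin = finite_monic_irreducibles[OF assms(1), of s]
  note ne = monic_irreducibles_nonempty[OF assms]
  {
    assume D: "equally_likely_factor p s D"
    obtain r where r: "r \<in> ?I" using ne by blast
    have eq: "pmf D q = pmf D r" if "q \<in> ?I" for q
      using D r that unfolding equally_likely_factor_def by blast
    have sub: "set_pmf D \<subseteq> ?I" using D unfolding equally_likely_factor_def by blast
    have "(\<Sum>q\<in>?I. pmf D q) = 1"
      using sub fin by (rule sum_pmf_eq_1[rotated])
    moreover have "(\<Sum>q\<in>?I. pmf D q) = (\<Sum>q\<in>?I. pmf D r)"
      by (rule sum.cong) (use eq in blast)+
    ultimately have "real (card ?I) * pmf D r = 1" by simp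
    hence r1: "pmf D r = 1 / card ?I"
      using fin ne by (simp add: nonzero_eq_divide_eq mult.commute)
    have zero: "pmf D q = 0" if "q \<notin> ?I" for q
      using sub that by (metis pmf_eq_0_set_pmf subsetD)
    show "D = pmf_of_set ?I"
    proof (rule pmf_eqI)
      fix q
      show "pmf D q = pmf (pmf_of_set ?I) q"
        using eq[of q] zero[of q] r1 pmf_of_set[OF ne fin, of q] by (cases "q \<in> ?I") simp_all
    qed
  }
  assume "D = pmf_of_set ?I"
  thus "equally_likely_factor p s D"
    using fin ne by (auto simp: equally_likely_factor_def)
qed

lemma prob_irreducible_eq_ratio:
  assumes "Factorial_Ring.prime p" "s \<ge> 1" "equally_likely_factor p s D"
  shows "prob_irreducible D s =
    real (card {q \<in> monic_irreducibles p s. Polynomials.degree q = s}) /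
    real (card (monic_irreducibles p s))"
proof -
  have "D = pmf_of_set (monic_irreducibles p s)"
    using assms equally_likely_factor_iff by blast
  thus ?thesis
    using finite_monic_irreducibles[OF assms(1)] monic_irreducibles_nonempty[OF assms(1,2)]
    by (simp add: prob_irreducible_def measure_pmf_of_set Int_def)
qed

end

theory Submission
  imports Defs
begin

text \<open>
  Over a field with \<open>q\<close> elements, write the degree of a monic \<open>f\<close> as the sum of \<open>deg P\<close> over all
  prime powers \<open>P\<^sup>j\<close> (\<open>j \<ge> 1\<close>) dividing \<open>f\<close>. Summing over the \<open>q\<^sup>n\<close> monic polynomials of degree
  \<open>n\<close>, and comparing \<open>n\<close> with \<open>n - 1\<close>, leaves Gauss's formula: \<open>q\<^sup>n\<close> is the sum of \<open>deg P\<close> over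
  all \<open>(P, j)\<close> with \<open>j * deg P = n\<close>. With \<open>N\<close> irreducibles of degree \<open>s\<close> and \<open>A\<close> of smaller
  degree this gives \<open>q\<^sup>s \<le> s * (N + A)\<close>, while trivially \<open>A * (q - 1) \<le> q\<^sup>s\<close>. So the
  proportion \<open>A / (A + N)\<close> of smaller degrees is at most \<open>s / (q - 1)\<close>, which already absorbs the
  error term. Leaving out the polynomial \<open>X\<close> only lowers \<open>A\<close> when \<open>s \<ge> 2\<close>, and for
  \<open>s = 1\<close> the proportion is zero.
\<close>

section \<open>Monic polynomials over a field: products, cofactors and counts\<close>

context field
begin

text \<open>Prescribing the length instead of the degree rules out the zero polynomial
  \<open>[]\<close>, whose degree is also 0 and whose leading coefficient is unspecified.\<close>

definition monics :: "nat \<Rightarrow> 'a list set" where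
  "monics n = {f \<in> carrier (poly_ring R). length f = Suc n \<and> Polynomials.lead_coeff f = \<one>}"

text \<open>The polynomial \<open>X\<close> is kept here, since Gauss's formula involves all
  irreducibles; it is removed only on passing to \<open>monic_irreducibles\<close>.\<close>

definition monic_irreds :: "nat \<Rightarrow> 'a list set" where
  "monic_irreds N = {P \<in> carrier (poly_ring R).
     pirreducible (carrier R) P \<and> Polynomials.lead_coeff P = \<one> \<and> Polynomials.degree P \<le> N}"

lemma monics_eq_image: "monics n = (#) \<one> ` {l. set l \<subseteq> carrier R \<and> length l = n}"
proof -
  have "f \<in> monics n \<longleftrightarrow> (\<exists>l. f = \<one> # l \<and> set l \<subseteq> carrier R \<and> length l = n)" for f
    by (cases f) (auto simp: monics_def univ_poly_carrier[symmetric] polynomial_def)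
  thus ?thesis by blast
qed

lemma card_monics:
  assumes "finite (carrier R)"
  shows "card (monics n) = card (carrier R) ^ n" and "finite (monics n)"
  using assms
  by (simp_all add: monics_eq_image card_image card_lists_length_eq finite_lists_length_eq)

lemma monics_mult:
  assumes "f \<in> monics a" "g \<in> monics b"
  shows "f \<otimes>\<^bsub>poly_ring R\<^esub> g \<in> monics (a + b)"
proof -
  interpret UP: domain "poly_ring R" by (rule univ_poly_is_domain[OF carrier_is_subring])
  have c: "f \<in> carrier (poly_ring R)" "g \<in> carrier (poly_ring R)" "f \<noteq> []" "g \<noteq> []"
    "length f = Suc a" "length g = Suc b" "Polynomials.lead_coeff f = \<one>" "Polynomials.lead_coeff g = \<one>"
    using assms by (auto simp: monics_def)
  note pol = c(1,2)[folded univ_poly_carrier]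
  have "f \<otimes>\<^bsub>poly_ring R\<^esub> g \<noteq> []"
    using UP.integral[OF _ c(1,2)] c(3,4) by (auto simp: univ_poly_zero)
  moreover have "Polynomials.degree (f \<otimes>\<^bsub>poly_ring R\<^esub> g) = a + b"
    using poly_mult_degree_eq[OF carrier_is_subring pol] c by (simp add: univ_poly_mult)
  moreover have "Polynomials.lead_coeff (f \<otimes>\<^bsub>poly_ring R\<^esub> g) = \<one>"
    using poly_mult_lead_coeff[OF carrier_is_subring pol c(3,4)] c by (simp add: univ_poly_mult)
  moreover have "f \<otimes>\<^bsub>poly_ring R\<^esub> g \<in> carrier (poly_ring R)" using c by simp
  ultimately show ?thesis
    by (cases "f \<otimes>\<^bsub>poly_ring R\<^esub> g") (auto simp: monics_def)
qed

text \<open>Over a domain degrees add and leading coefficients multiply, so dividing a monic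
  polynomial by a monic one leaves a monic quotient.\<close>

lemma monics_cofactor:
  assumes "f \<in> monics a" "g \<in> carrier (poly_ring R)" "f \<otimes>\<^bsub>poly_ring R\<^esub> g \<in> monics n"
  shows "a \<le> n" and "g \<in> monics (n - a)"
proof -
  interpret UP: domain "poly_ring R" by (rule univ_poly_is_domain[OF carrier_is_subring])
  have c: "f \<in> carrier (poly_ring R)" "f \<noteq> []" "length f = Suc a" "Polynomials.lead_coeff f = \<one>"
    using assms by (auto simp: monics_def)
  note pol = c(1)[folded univ_poly_carrier] assms(2)[folded univ_poly_carrier]
  have "g \<noteq> []"
    using assms(3) c(1) UP.r_null[OF c(1)] by (auto simp: monics_def univ_poly_zero)
  moreover from this have "n = a + Polynomials.degree g"
    using poly_mult_degree_eq[OF carrier_is_subring pol] c assms(3)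
    by (simp add: univ_poly_mult monics_def)
  moreover have "Polynomials.lead_coeff g = \<one>"
  proof -
    have "Polynomials.lead_coeff g \<in> carrier R"
      using pol(2) \<open>g \<noteq> []\<close> by (auto simp: polynomial_def)
    thus ?thesis
      using poly_mult_lead_coeff[OF carrier_is_subring pol c(2) \<open>g \<noteq> []\<close>] c assms(3)
      by (simp add: univ_poly_mult monics_def)
  qed
  ultimately show "a \<le> n" "g \<in> monics (n - a)"
    using assms(2) by (cases g; auto simp: monics_def)+
qed

lemma monics_pow:
  assumes "P \<in> monics d"
  shows "P [^]\<^bsub>poly_ring R\<^esub> (j::nat) \<in> monics (j * d)"
proof (induction j)
  case 0
  thus ?case
    using carrier_is_subring
    by (auto simp: nat_pow_def univ_poly_one monics_def univ_poly_carrier[symmetric] polynomial_def)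
next
  case (Suc j)
  have "P [^]\<^bsub>poly_ring R\<^esub> Suc j = P [^]\<^bsub>poly_ring R\<^esub> j \<otimes>\<^bsub>poly_ring R\<^esub> P"
    by (simp add: nat_pow_def)
  thus ?case using monics_mult[OF Suc assms] by (simp add: add.commute)
qed

text \<open>Multiplication by \<open>P\<close> is a bijection from the monic polynomials of degree
  \<open>n - d\<close> onto the multiples being counted, by cancellation in a domain.\<close>

lemma card_monics_multiples:
  assumes "finite (carrier R)" "P \<in> monics d"
  shows "card {f \<in> monics n. P pdivides f} = (if d \<le> n then card (carrier R) ^ (n - d) else 0)"
proof (cases "d \<le> n")
  case True
  interpret UP: domain "poly_ring R" by (rule univ_poly_is_domain[OF carrier_is_subring])
  have P: "P \<in> carrier (poly_ring R)" "P \<noteq> []" using assms by (auto simp: monics_def)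
  have "{f \<in> monics n. P pdivides f} = (\<lambda>g. P \<otimes>\<^bsub>poly_ring R\<^esub> g) ` monics (n - d)"
  proof (intro equalityI subsetI)
    fix f assume "f \<in> {f \<in> monics n. P pdivides f}"
    then obtain g where "g \<in> carrier (poly_ring R)" "f = P \<otimes>\<^bsub>poly_ring R\<^esub> g" "f \<in> monics n"
      by (auto simp: pdivides_def factor_def)
    thus "f \<in> (\<lambda>g. P \<otimes>\<^bsub>poly_ring R\<^esub> g) ` monics (n - d)"
      using monics_cofactor(2)[OF assms(2)] by blast
  next
    fix f assume "f \<in> (\<lambda>g. P \<otimes>\<^bsub>poly_ring R\<^esub> g) ` monics (n - d)"
    then obtain g where g: "g \<in> monics (n - d)" "f = P \<otimes>\<^bsub>poly_ring R\<^esub> g" by blast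
    hence "f \<in> monics n" using monics_mult[OF assms(2) g(1)] True by simp
    moreover have "g \<in> carrier (poly_ring R)" using g(1) by (simp add: monics_def)
    ultimately show "f \<in> {f \<in> monics n. P pdivides f}"
      using g(2) by (auto simp: pdivides_def factor_def)
  qed
  moreover have "inj_on (\<lambda>g. P \<otimes>\<^bsub>poly_ring R\<^esub> g) (monics (n - d))"
    using P by (auto simp: inj_on_def monics_def UP.m_lcancel univ_poly_zero)
  ultimately show ?thesis
    using True card_monics[OF assms(1)] by (simp add: card_image)
next
  case False
  hence "{f \<in> monics n. P pdivides f} = {}"
    using monics_cofactor(1)[OF assms(2)] by (auto simp: pdivides_def factor_def)
  thus ?thesis using False by (simp only: card.empty if_False)
qed

section \<open>Monic irreducible polynomials and divisibility\<close>

lemma monic_irreds_monics: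
  assumes "P \<in> monic_irreds N"
  shows "P \<in> monics (Polynomials.degree P)" "1 \<le> Polynomials.degree P" "Polynomials.degree P \<le> N"
proof -
  have P: "P \<in> carrier (poly_ring R)" "pirreducible (carrier R) P" "Polynomials.lead_coeff P = \<one>"
    using assms by (auto simp: monic_irreds_def)
  show "1 \<le> Polynomials.degree P" by (rule pirreducible_degree[OF carrier_is_subfield P(1,2)])
  thus "P \<in> monics (Polynomials.degree P)" using P by (auto simp: monics_def)
  show "Polynomials.degree P \<le> N" using assms by (auto simp: monic_irreds_def)
qed

text \<open>A nonunit dividing an irreducible is associated to it, so the two differ by a nonzero
  constant; comparing leading coefficients forces this constant to be \<open>\<one>\<close>.\<close>

lemma monic_irreds_pdivides_eq:
  assumes "P \<in> monic_irreds N" "Q \<in> monic_irreds N" "P pdivides Q"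
  shows "P = Q"
proof -
  interpret UP: domain "poly_ring R" by (rule univ_poly_is_domain[OF carrier_is_subring])
  have P: "P \<in> carrier (poly_ring R)" "pirreducible (carrier R) P" "Polynomials.lead_coeff P = \<one>"
    and Q: "Q \<in> carrier (poly_ring R)" "pirreducible (carrier R) Q" "Polynomials.lead_coeff Q = \<one>"
    using assms by (auto simp: monic_irreds_def)
  have "P \<notin> Units (poly_ring R)"
    by (rule pirreducibleE(2)[OF carrier_is_subring P(1,2)])
  hence "P \<sim>\<^bsub>poly_ring R\<^esub> Q"
    using divides_pirreducible_condition[OF Q(2) P(1)] assms(3) by (auto simp: pdivides_def)
  then obtain k where k: "k \<in> carrier R - {\<zero>}" "P = [k] \<otimes>\<^bsub>poly_ring R\<^esub> Q"
    using associated_polynomials_iff[OF carrier_is_subfield P(1) Q(1)] by blast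
  have "P = map (\<lambda>b. k \<otimes> b) Q"
    using poly_mult_const(1)[OF carrier_is_subring Q(1)[folded univ_poly_carrier] k(1)] k(2)
    by (simp add: univ_poly_mult)
  moreover have "Q \<noteq> []" by (rule pirreducibleE(1)[OF carrier_is_subring Q(1,2)])
  ultimately have "\<one> = k \<otimes> \<one>" using P(3) Q(3) by (cases Q) auto
  hence "[k] = \<one>\<^bsub>poly_ring R\<^esub>" using k(1) by (simp add: univ_poly_one)
  thus ?thesis using k(2) Q(1) by simp
qed

text \<open>A nonunit in a principal ideal domain has an irreducible divisor, which can be rescaled
  to be monic. The cofactor has smaller degree, which makes induction on the degree
  possible.\<close>

lemma exists_monic_irred_divisor:
  assumes "f \<in> monics n" "1 \<le> n"
  obtains Q g where "Q \<in> monic_irreds n" "g \<in> monics (n - Polynomials.degree Q)"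
    "f = Q \<otimes>\<^bsub>poly_ring R\<^esub> g"
proof -
  interpret UP: principal_domain "poly_ring R"
    by (rule univ_poly_is_principal[OF carrier_is_subfield])
  have f: "f \<in> carrier (poly_ring R)" "f \<noteq> []" "Polynomials.degree f = n"
    using assms(1) by (auto simp: monics_def)
  have "f \<notin> Units (poly_ring R)"
    using assms f by (auto simp: univ_poly_units'[OF carrier_is_subfield])
  moreover have "f \<in> carrier (poly_ring R) - {\<zero>\<^bsub>poly_ring R\<^esub>}"
    using f by (simp add: univ_poly_zero)
  ultimately obtain q where q: "q \<in> carrier (poly_ring R)" "pirreducible (carrier R) q"
      "q divides\<^bsub>poly_ring R\<^esub> f"
    using UP.exists_irreducible_divisor by blast
  have "q \<noteq> []" by (rule pirreducibleE(1)[OF carrier_is_subring q(1,2)])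
  then obtain a q' where aq: "q = a # q'" by (cases q) auto
  have a: "a \<in> carrier R - {\<zero>}"
    using q(1) aq by (auto simp: univ_poly_carrier[symmetric] polynomial_def)
  hence ia: "inv a \<in> carrier R - {\<zero>}" using field_Units by auto
  \<comment> \<open>Since \<open>[inv a]\<close> is a unit, \<open>Q\<close> stays irreducible and
    still divides \<open>f\<close>, while its leading coefficient becomes
    \<open>\<one>\<close>.\<close>
  define Q where "Q = [inv a] \<otimes>\<^bsub>poly_ring R\<^esub> q"
  have unit: "[inv a] \<in> Units (poly_ring R)"
    using ia by (simp add: univ_poly_carrier_units)
  have Qc: "Q \<in> carrier (poly_ring R)" using unit q(1) by (simp add: Q_def UP.Units_closed)
  have Qm: "Q = map (\<lambda>b. inv a \<otimes> b) q"
    using poly_mult_const(1)[OF carrier_is_subring q(1)[folded univ_poly_carrier] ia]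
    by (simp add: univ_poly_mult Q_def)
  hence lQ: "Polynomials.lead_coeff Q = \<one>" using a aq field_Units by simp
  have "Divisibility.irreducible (poly_ring R) Q"
    unfolding Q_def using q unit
    by (intro UP.irreducible_prod_lI) (auto simp: ring_irreducible_def)
  moreover have "Q \<noteq> []" using Qm aq by simp
  ultimately have Qi: "pirreducible (carrier R) Q"
    by (simp add: ring_irreducible_def univ_poly_zero)
  have "Q divides\<^bsub>poly_ring R\<^esub> f"
  proof -
    have "Q \<sim>\<^bsub>poly_ring R\<^esub> q"
      unfolding associated_polynomials_iff[OF carrier_is_subfield Qc q(1)] using ia Q_def by blast
    thus ?thesis using q Qc f UP.divides_trans[of Q q f] by (auto simp: associated_def)
  qed
  then obtain g where g: "g \<in> carrier (poly_ring R)" "f = Q \<otimes>\<^bsub>poly_ring R\<^esub> g"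
    by (auto simp: factor_def)
  have Qd: "Q \<in> monics (Polynomials.degree Q)" using Qc lQ \<open>Q \<noteq> []\<close> by (cases Q) (auto simp: monics_def)
  note cof = monics_cofactor[OF Qd g(1), of n]
  have "Q \<in> monic_irreds n" using Qc Qi lQ cof assms(1) g(2) by (auto simp: monic_irreds_def)
  thus thesis using that cof assms(1) g(2) by blast
qed

lemma finite_monic_irreds:
  assumes "finite (carrier R)"
  shows "finite (monic_irreds N)"
proof (rule finite_subset)
  show "monic_irreds N \<subseteq> (\<Union>n\<le>N. monics n)"
    using monic_irreds_monics by fast
  show "finite (\<Union>n\<le>N. monics n)" using card_monics(2)[OF assms] by simp
qed

section \<open>Prime-power divisors and Gauss's formula\<close>

lemma monic_pow_pdivides_degree:
  assumes "P \<in> monics d" "P [^]\<^bsub>poly_ring R\<^esub> (j::nat) pdivides f" "f \<in> monics n"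
  shows "j * d \<le> n"
proof -
  obtain g where "g \<in> carrier (poly_ring R)" "f = P [^]\<^bsub>poly_ring R\<^esub> j \<otimes>\<^bsub>poly_ring R\<^esub> g"
    using assms(2) by (auto simp: pdivides_def factor_def)
  thus ?thesis using monics_cofactor(1)[OF monics_pow[OF assms(1)]] assms(3) by blast
qed

lemma monic_pow_Suc_pdivides_iff:
  assumes "Q \<in> monics d" "g \<in> monics n"
  shows "Q [^]\<^bsub>poly_ring R\<^esub> Suc j pdivides (Q \<otimes>\<^bsub>poly_ring R\<^esub> g) \<longleftrightarrow>
    Q [^]\<^bsub>poly_ring R\<^esub> j pdivides g"
proof -
  interpret UP: domain "poly_ring R" by (rule univ_poly_is_domain[OF carrier_is_subring])
  have c: "Q \<in> carrier (poly_ring R)" "Q \<noteq> []" "g \<in> carrier (poly_ring R)"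
    using assms by (auto simp: monics_def)
  have "Q [^]\<^bsub>poly_ring R\<^esub> Suc j = Q \<otimes>\<^bsub>poly_ring R\<^esub> Q [^]\<^bsub>poly_ring R\<^esub> j"
    using c UP.nat_pow_Suc2 by blast
  thus ?thesis
    using c by (auto simp: pdivides_def factor_def UP.m_assoc UP.m_lcancel univ_poly_zero)
qed

text \<open>The inner sum is \<open>deg P\<close> times the multiplicity of \<open>P\<close> in
  \<open>f\<close>. Induction splits off one irreducible factor \<open>Q\<close>, which changes only
  the term of \<open>Q\<close>, raising it by \<open>deg Q\<close>. The bound \<open>N\<close> is
  separate from \<open>n\<close> so that \<open>f\<close> and its cofactor are summed over the same
  index set.\<close>

lemma degree_eq_sum_prime_powers:
  assumes fin: "finite (carrier R)"
  shows "f \<in> monics n \<Longrightarrow> n \<le> N \<Longrightarrow>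
    (\<Sum>P\<in>monic_irreds N. \<Sum>j=1..N.
       if P [^]\<^bsub>poly_ring R\<^esub> j pdivides f then Polynomials.degree P else 0) = n"
proof (induction n arbitrary: f rule: less_induct)
  case (less n)
  show ?case
  proof (cases "n = 0")
    case True
    have "\<not> P [^]\<^bsub>poly_ring R\<^esub> j pdivides f" if "P \<in> monic_irreds N" "j \<in> {1..N}" for P j
      using monic_pow_pdivides_degree[OF monic_irreds_monics(1)[OF that(1)] _ less.prems(1), of j]
        monic_irreds_monics(2)[OF that(1)] that(2) True by fastforce
    thus ?thesis using True by (auto intro!: sum.neutral)
  next
    case False
    hence "1 \<le> n" by simp
    with less.prems(1) obtain Q g where Qn: "Q \<in> monic_irreds n" and g: "g \<in> monics (n - Polynomials.degree Q)"
      and f: "f = Q \<otimes>\<^bsub>poly_ring R\<^esub> g"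
      by (rule exists_monic_irred_divisor)
    have Q: "Q \<in> monic_irreds N" using Qn less.prems(2) by (auto simp: monic_irreds_def)
    note Qm = monic_irreds_monics[OF Qn]
    let ?w = "\<lambda>f P. \<Sum>j=1..N. if P [^]\<^bsub>poly_ring R\<^esub> j pdivides f then Polynomials.degree P else 0"
    let ?t = "\<lambda>j::nat. if Q [^]\<^bsub>poly_ring R\<^esub> j pdivides g then Polynomials.degree Q else 0"
    have "?w f P = ?w g P" if P: "P \<in> monic_irreds N - {Q}" for P
    proof -
      \<comment> \<open>As the irreducible \<open>P\<close> does not divide \<open>Q\<close>, a
        power of \<open>P\<close> divides \<open>Q\<close> times \<open>g\<close> only if it divides
        \<open>g\<close>.\<close>
      have "\<not> P pdivides Q" using monic_irreds_pdivides_eq[of P N Q] P Q by blast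
      hence "P [^]\<^bsub>poly_ring R\<^esub> j pdivides f \<longleftrightarrow> P [^]\<^bsub>poly_ring R\<^esub> j pdivides g"
        for j :: nat
        unfolding f using P Q g
        by (intro pirreducible_pow_pdivides_iff[OF carrier_is_subfield])
          (auto simp: monic_irreds_def monics_def)
      thus ?thesis by simp
    qed
    moreover have "?w f Q = ?w g Q + Polynomials.degree Q"
    proof -
      \<comment> \<open>Cancelling one \<open>Q\<close> turns the exponents 1 to \<open>N\<close>
        for \<open>f\<close> into 0 to \<open>N - 1\<close> for \<open>g\<close>. The new exponent 0
        always counts and yields the extra \<open>deg Q\<close>.\<close>
      have "?w f Q = (\<Sum>j=Suc 0..<Suc N. if Q [^]\<^bsub>poly_ring R\<^esub> j pdivides f then Polynomials.degree Q else 0)"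
        by (simp add: atLeastLessThanSuc_atLeastAtMost)
      also have "\<dots> = (\<Sum>j=0..<N. if Q [^]\<^bsub>poly_ring R\<^esub> Suc j pdivides f then Polynomials.degree Q else 0)"
        by (rule sum.shift_bounds_Suc_ivl)
      also have "\<dots> = (\<Sum>j=0..<N. ?t j)"
        unfolding f monic_pow_Suc_pdivides_iff[OF Qm(1) g] ..
      also have "\<dots> = (\<Sum>j=0..N. ?t j)"
      proof -
        \<comment> \<open>The exponent \<open>N\<close> may be added back to the range: the
          \<open>N\<close>-th power of \<open>Q\<close> has degree at least \<open>N\<close>, which
          exceeds the degree of \<open>g\<close>.\<close>
        have "\<not> Q [^]\<^bsub>poly_ring R\<^esub> N pdivides g"
        proof
          assume "Q [^]\<^bsub>poly_ring R\<^esub> N pdivides g"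
          hence "N * Polynomials.degree Q \<le> n - Polynomials.degree Q"
            by (rule monic_pow_pdivides_degree[OF Qm(1) _ g])
          moreover have "N * 1 \<le> N * Polynomials.degree Q" using Qm(2) by (rule mult_le_mono2)
          ultimately show False using Qm(2) less.prems(2) False by linarith
        qed
        thus ?thesis by (simp add: atLeastLessThanSuc_atLeastAtMost[symmetric])
      qed
      also have "\<dots> = ?t 0 + ?w g Q"
        using sum.atLeast_Suc_atMost[of 0 N ?t] by (simp only: One_nat_def le0 simp_thms)
      also have "?t 0 = Polynomials.degree Q"
      proof -
        interpret UP: domain "poly_ring R" by (rule univ_poly_is_domain[OF carrier_is_subring])
        have "Q [^]\<^bsub>poly_ring R\<^esub> (0::nat) pdivides g"
          using g UP.one_divides[of g] by (simp add: pdivides_def monics_def)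
        thus ?thesis by simp
      qed
      finally show ?thesis by simp
    qed
    ultimately have "?w f Q + (\<Sum>P\<in>monic_irreds N - {Q}. ?w f P) =
        ?w g Q + Polynomials.degree Q + (\<Sum>P\<in>monic_irreds N - {Q}. ?w g P)"
      by (metis (no_types, lifting) sum.cong)
    hence "(\<Sum>P\<in>monic_irreds N. ?w f P) =
        (\<Sum>P\<in>monic_irreds N. ?w g P) + Polynomials.degree Q"
      unfolding sum.remove[OF finite_monic_irreds[OF fin] Q, of "?w f"]
        sum.remove[OF finite_monic_irreds[OF fin] Q, of "?w g"] by linarith
    also have "(\<Sum>P\<in>monic_irreds N. ?w g P) = n - Polynomials.degree Q"
      by (rule less.IH[OF _ g]) (use Qm less.prems(2) False in linarith)+
    finally show ?thesis using Qm by simp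
  qed
qed

text \<open>Double counting: the degree formula is summed over all monic polynomials of degree
  \<open>n\<close> and the sums are exchanged. The choice of \<open>N\<close> is left free so that
  two consecutive values of \<open>n\<close> can share one index set.\<close>

lemma sum_degree_monics:
  assumes fin: "finite (carrier R)" and "n \<le> N"
  shows "n * card (carrier R) ^ n = (\<Sum>P\<in>monic_irreds N. \<Sum>j=1..N.
    if j * Polynomials.degree P \<le> n then Polynomials.degree P * card (carrier R) ^ (n - j * Polynomials.degree P) else 0)"
proof -
  have "n * card (carrier R) ^ n = (\<Sum>f\<in>monics n. n)"
    using card_monics[OF fin] by simp
  also have "\<dots> = (\<Sum>f\<in>monics n. \<Sum>P\<in>monic_irreds N. \<Sum>j=1..N.
      if P [^]\<^bsub>poly_ring R\<^esub> j pdivides f then Polynomials.degree P else 0)"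
    using degree_eq_sum_prime_powers[OF fin _ assms(2)] by simp
  also have "\<dots> = (\<Sum>P\<in>monic_irreds N. \<Sum>j=1..N. \<Sum>f\<in>monics n.
      if P [^]\<^bsub>poly_ring R\<^esub> j pdivides f then Polynomials.degree P else 0)"
    by (subst sum.swap, rule sum.cong[OF refl], subst sum.swap) simp
  also have "\<dots> = (\<Sum>P\<in>monic_irreds N. \<Sum>j=1..N.
      if j * Polynomials.degree P \<le> n then Polynomials.degree P * card (carrier R) ^ (n - j * Polynomials.degree P) else 0)"
  proof (intro sum.cong refl)
    fix P and j :: nat assume P: "P \<in> monic_irreds N"
    have "(\<Sum>f\<in>monics n. if P [^]\<^bsub>poly_ring R\<^esub> j pdivides f then Polynomials.degree P else 0) =
        Polynomials.degree P * card {f \<in> monics n. P [^]\<^bsub>poly_ring R\<^esub> j pdivides f}"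
      using card_monics(2)[OF fin] by (simp add: sum.If_cases Int_def)
    thus "(\<Sum>f\<in>monics n. if P [^]\<^bsub>poly_ring R\<^esub> j pdivides f then Polynomials.degree P else 0) =
        (if j * Polynomials.degree P \<le> n then Polynomials.degree P * card (carrier R) ^ (n - j * Polynomials.degree P) else 0)"
      using card_monics_multiples[OF fin monics_pow[OF monic_irreds_monics(1)[OF P]]] by simp
  qed
  finally show ?thesis .
qed

text \<open>For each \<open>P\<close> whose degree divides \<open>Suc n\<close> exactly one
  \<open>j\<close> contributes, so the right-hand side is the familiar sum of \<open>d\<close> times
  the number of monic irreducibles of degree \<open>d\<close>, over all \<open>d\<close> dividing
  \<open>Suc n\<close>.\<close>

theorem sum_degree_monic_irreds:
  assumes fin: "finite (carrier R)"
  shows "card (carrier R) ^ Suc n =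
    (\<Sum>P\<in>monic_irreds (Suc n). \<Sum>j=1..Suc n. if j * Polynomials.degree P = Suc n then Polynomials.degree P else 0)"
proof -
  let ?q = "card (carrier R)" and ?I = "monic_irreds (Suc n)"
  let ?t = "\<lambda>m P j. if j * Polynomials.degree P \<le> m then Polynomials.degree P * ?q ^ (m - j * Polynomials.degree P) else 0"
  let ?e = "\<lambda>P j. if j * Polynomials.degree P = Suc n then Polynomials.degree P else 0"
  \<comment> \<open>Passing from \<open>n\<close> to \<open>Suc n\<close> multiplies every old term
    by \<open>?q\<close>; only the pairs with \<open>j * deg P = Suc n\<close> are new. On the left
    the same comparison leaves \<open>(Suc n - n) * ?q ^ Suc n\<close>.\<close>
  have step: "?t (Suc n) P j = ?q * ?t n P j + ?e P j" for P j
    by (auto simp: Suc_diff_le le_Suc_eq)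
  have "Suc n * ?q ^ Suc n = (\<Sum>P\<in>?I. \<Sum>j=1..Suc n. ?t (Suc n) P j)"
    by (rule sum_degree_monics[OF fin order_refl])
  also have "\<dots> = (\<Sum>P\<in>?I. \<Sum>j=1..Suc n. ?q * ?t n P j + ?e P j)"
    by (intro sum.cong refl) (rule step)
  also have "\<dots> = ?q * (\<Sum>P\<in>?I. \<Sum>j=1..Suc n. ?t n P j) + (\<Sum>P\<in>?I. \<Sum>j=1..Suc n. ?e P j)"
    by (simp only: sum.distrib sum_distrib_left)
  also have "(\<Sum>P\<in>?I. \<Sum>j=1..Suc n. ?t n P j) = n * ?q ^ n"
    by (rule sum_degree_monics[OF fin, symmetric]) simp
  finally show ?thesis by simp
qed

section \<open>Bounds on the numbers of irreducibles\<close>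

text \<open>In Gauss's formula each \<open>P\<close> contributes 0 or \<open>deg P\<close>, hence at
  most \<open>s\<close>, whatever its degree.\<close>

lemma card_monic_irreds_lower:
  assumes fin: "finite (carrier R)" and "1 \<le> s"
  shows "card (carrier R) ^ s \<le>
    s * card {P \<in> monic_irreds s. Polynomials.degree P = s} +
    s * card {P \<in> monic_irreds s. Polynomials.degree P < s}"
proof -
  have "(\<Sum>j=1..s. if j * Polynomials.degree P = s then Polynomials.degree P else 0) \<le> s" if "P \<in> monic_irreds s" for P
  proof -
    \<comment> \<open>Only \<open>j = s div deg P\<close> can satisfy the equation, so the sum
      collapses to at most one term.\<close>
    have "(\<Sum>j=1..s. if j * Polynomials.degree P = s then Polynomials.degree P else 0) \<le>
        (\<Sum>j=1..s. if s div Polynomials.degree P = j then Polynomials.degree P else 0)"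
      using monic_irreds_monics(2)[OF that] by (intro sum_mono) auto
    also have "\<dots> \<le> s" using monic_irreds_monics(3)[OF that] by simp
    finally show ?thesis .
  qed
  hence "(\<Sum>P\<in>monic_irreds s. \<Sum>j=1..s. if j * Polynomials.degree P = s then Polynomials.degree P else 0)
      \<le> (\<Sum>P\<in>monic_irreds s. s)"
    by (rule sum_mono)
  moreover have "Suc (s - 1) = s" using assms(2) by simp
  ultimately have "card (carrier R) ^ s \<le> (\<Sum>P\<in>monic_irreds s. s)"
    using sum_degree_monic_irreds[OF fin, of "s - 1"] by (simp only:)
  hence "card (carrier R) ^ s \<le> s * card (monic_irreds s)"
    by (simp add: mult.commute)
  also have "card (monic_irreds s) = card ({P \<in> monic_irreds s. Polynomials.degree P = s} \<union>
      {P \<in> monic_irreds s. Polynomials.degree P < s})"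
  proof (rule arg_cong[where f = card], intro equalityI subsetI)
    fix P assume "P \<in> monic_irreds s"
    thus "P \<in> {P \<in> monic_irreds s. Polynomials.degree P = s} \<union>
        {P \<in> monic_irreds s. Polynomials.degree P < s}"
      using monic_irreds_monics(3)[of P s] by auto
  qed auto
  also have "s * card ({P \<in> monic_irreds s. Polynomials.degree P = s} \<union>
      {P \<in> monic_irreds s. Polynomials.degree P < s}) \<le>
      s * (card {P \<in> monic_irreds s. Polynomials.degree P = s} +
      card {P \<in> monic_irreds s. Polynomials.degree P < s})"
    by (intro mult_le_mono2 card_Un_le)
  finally show ?thesis by (simp only: distrib_left)
qed

text \<open>All monic polynomials of degree below \<open>s\<close> are counted, irreducible or not,
  and their number is a geometric sum.\<close>

lemma card_monic_irreds_lower_degree: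
  assumes fin: "finite (carrier R)"
  shows "card {P \<in> monic_irreds s. Polynomials.degree P < s} * (card (carrier R) - 1) \<le> card (carrier R) ^ s"
proof -
  let ?q = "card (carrier R)"
  have q: "0 < ?q" using fin by (auto simp: card_gt_0_iff)
  have "{P \<in> monic_irreds s. Polynomials.degree P < s} \<subseteq> (\<Union>n<s. monics n)"
    using monic_irreds_monics(1) by fast
  hence "card {P \<in> monic_irreds s. Polynomials.degree P < s} \<le> card (\<Union>n<s. monics n)"
    using card_monics[OF fin] by (intro card_mono) auto
  also have "\<dots> \<le> (\<Sum>n<s. ?q ^ n)"
    using card_UN_le[of "{..<s}" monics] card_monics[OF fin] by simp
  finally have "card {P \<in> monic_irreds s. Polynomials.degree P < s} * (?q - 1) \<le> (\<Sum>n<s. ?q ^ n) * (?q - 1)"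
    by (rule mult_le_mono1)
  also have "\<dots> \<le> ?q ^ s"
  proof (induction s)
    case (Suc s)
    have "?q ^ Suc s = ?q ^ s + ?q ^ s * (?q - 1)"
      using q by (cases ?q) auto
    thus ?case using Suc by (simp add: distrib_right)
  qed simp
  finally show ?thesis .
qed

end

section \<open>The residue field and the probability estimate\<close>

text \<open>The two counting bounds are first combined for the set including \<open>X\<close> and
  then transferred to \<open>monic_irreducibles\<close>. For \<open>s \<ge> 2\<close> the removal of
  \<open>X\<close>, of degree 1, leaves \<open>N\<close> unchanged and can only lower
  \<open>A\<close>.\<close>

lemma card_lower_degree_bound:
  assumes p: "Factorial_Ring.prime p" and s: "2 \<le> s" "s < p"
  defines "A \<equiv> card {q \<in> monic_irreducibles p s. Polynomials.degree q < s}"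
  defines "N \<equiv> card {q \<in> monic_irreducibles p s. Polynomials.degree q = s}"
  shows "A * (p - 1) \<le> s * (A + N)"
proof -
  interpret F: field "residue_ring (int p)" by (rule residue_field[OF p])
  have fin: "finite (carrier (residue_ring (int p)))" by (simp add: residue_ring_def)
  have card: "card (carrier (residue_ring (int p))) = p"
    by (simp add: residue_ring_def)
  let ?A = "card {P \<in> F.monic_irreds s. Polynomials.degree P < s}"
  have "monic_irreducibles p s = F.monic_irreds s - {X\<^bsub>residue_ring (int p)\<^esub>}"
    by (auto simp: monic_irreducibles_def F.monic_irreds_def)
  moreover have "Polynomials.degree X\<^bsub>residue_ring (int p)\<^esub> = 1" by (simp add: var_def)
  ultimately have N: "N = card {P \<in> F.monic_irreds s. Polynomials.degree P = s}"
    and "A \<le> ?A"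
    unfolding N_def A_def using s F.finite_monic_irreds[OF fin]
    by (auto intro!: arg_cong[where f = card] card_mono)
  have "?A * (p - 1) \<le> s * N + s * ?A"
    using F.card_monic_irreds_lower_degree[OF fin, of s] F.card_monic_irreds_lower[OF fin, of s] s
    unfolding card N by linarith
  \<comment> \<open>\<open>?A\<close> occurs on both sides, so it cannot be replaced by the smaller
    \<open>A\<close> directly. Moving \<open>s * ?A\<close> to the left gives a bound monotone in
    \<open>?A\<close>; \<open>s < p\<close> keeps the natural subtraction exact.\<close>
  moreover have split: "x * (p - 1) = x * (p - 1 - s) + s * x" for x
  proof -
    have "p - 1 = (p - 1 - s) + s" using s by simp
    thus ?thesis by (metis distrib_left mult.commute)
  qed
  ultimately have "?A * (p - 1 - s) \<le> s * N" unfolding split[of ?A] by linarith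
  hence "A * (p - 1 - s) \<le> s * N" using mult_le_mono1[OF \<open>A \<le> ?A\<close>] le_trans by blast
  thus ?thesis unfolding split[of A] by (simp add: distrib_left)
qed

lemma prob_irreducible_lower_bound:
  assumes p: "Factorial_Ring.prime p" and s: "1 \<le> s" "s < p"
    and D: "equally_likely_factor p s D"
  shows "prob_irreducible D s \<ge> 1 - real s / (real p - 1)"
proof -
  interpret F: field "residue_ring (int p)" by (rule residue_field[OF p])
  define A where "A = card {q \<in> monic_irreducibles p s. Polynomials.degree q < s}"
  define N where "N = card {q \<in> monic_irreducibles p s. Polynomials.degree q = s}"
  note fin = finite_monic_irreducibles[OF p, of s]
  have p1: "real p - 1 > 0" using prime_gt_1_nat[OF p] by simp
  have "monic_irreducibles p s = {q \<in> monic_irreducibles p s. Polynomials.degree q < s} \<union>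
      {q \<in> monic_irreducibles p s. Polynomials.degree q = s}"
    by (auto simp: monic_irreducibles_def)
  also have "card \<dots> = A + N"
    unfolding A_def N_def using fin by (intro card_Un_disjoint) auto
  finally have T: "card (monic_irreducibles p s) = A + N" .
  have pos: "real A + real N > 0"
    using monic_irreducibles_nonempty[OF p s(1)] fin T
    by (metis card_gt_0_iff of_nat_0_less_iff of_nat_add)
  have "A * (p - 1) \<le> s * (A + N)"
  proof (cases "s = 1")
    \<comment> \<open>Here removing \<open>X\<close> would lower \<open>N\<close> instead of
      \<open>A\<close>, but irreducibles have degree at least 1, so \<open>A\<close> is
      zero.\<close>
    case True
    have "Polynomials.degree q \<ge> 1" if "q \<in> monic_irreducibles p s" for q
      using that F.pirreducible_degree[OF F.carrier_is_subfield, of q]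
      by (auto simp: monic_irreducibles_def)
    hence "{q \<in> monic_irreducibles p s. Polynomials.degree q < s} = {}" using True by force
    hence "A = 0" unfolding A_def by (simp only: card.empty)
    thus ?thesis by simp
  next
    case False
    thus ?thesis unfolding A_def N_def using card_lower_degree_bound[OF p _ s(2)] s(1) by simp
  qed
  hence "real (A * (p - 1)) \<le> real (s * (A + N))" by (rule of_nat_mono)
  hence "real A * (real p - 1) \<le> real s * (real A + real N)"
    using prime_gt_1_nat[OF p] by (simp add: of_nat_diff)
  hence "real A / (real A + real N) \<le> real s / (real p - 1)"
    using pos p1 by (simp add: divide_simps mult.commute)
  moreover have "prob_irreducible D s = 1 - real A / (real A + real N)"
    using prob_irreducible_eq_ratio[OF p s(1) D] pos
    unfolding T N_def[symmetric] by (simp add: field_simps)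
  ultimately show ?thesis by simp
qed

theorem theorem1:
  shows "\<exists>C::real. C > 0 \<and>
    (\<forall>(g::int poly) (s::nat).
       s \<ge> 1 \<and> Polynomial.degree g = s \<and> Polynomial.lead_coeff g = 1 \<and> Factorial_Ring.irreducible g \<longrightarrow>
       (\<exists>P::nat. \<forall>p\<ge>P. Factorial_Ring.prime p \<longrightarrow>
          (\<forall>(h::int list) (D::int list pmf).
             h = reduce_mod p g \<and>
             \<one>\<^bsub>poly_ring (residue_ring (int p))\<^esub>
               gcdof\<^bsub>poly_ring (residue_ring (int p))\<^esub> h X\<^bsub>residue_ring (int p)\<^esub> \<and>
             Polynomials.degree h = s \<and>
             equally_likely_factor p s D \<longrightarrow>
             prob_irreducible D s
               \<ge> 1 - (real s + 1) / (real p - 1) - C * ((real s)\<^sup>2 / (real p - 1)\<^sup>2))))"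
\<comment> \<open>The bound \<open>1 - s / (p - 1)\<close> already lies above the main term, so any
  positive constant serves as \<open>C\<close>.\<close>
proof (intro exI[of _ "1::real"] conjI allI impI)
  fix g :: "int poly" and s :: nat
  assume s: "s \<ge> 1 \<and> Polynomial.degree g = s \<and> Polynomial.lead_coeff g = 1 \<and>
    Factorial_Ring.irreducible g"
  show "\<exists>P::nat. \<forall>p\<ge>P. Factorial_Ring.prime p \<longrightarrow>
          (\<forall>(h::int list) (D::int list pmf).
             h = reduce_mod p g \<and>
             \<one>\<^bsub>poly_ring (residue_ring (int p))\<^esub>
               gcdof\<^bsub>poly_ring (residue_ring (int p))\<^esub> h X\<^bsub>residue_ring (int p)\<^esub> \<and>
             Polynomials.degree h = s \<and>
             equally_likely_factor p s D \<longrightarrow>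
             prob_irreducible D s
               \<ge> 1 - (real s + 1) / (real p - 1) - 1 * ((real s)\<^sup>2 / (real p - 1)\<^sup>2))"
  \<comment> \<open>The threshold \<open>Suc s\<close> is the condition \<open>s < p\<close> of
    \<open>prob_irreducible_lower_bound\<close>.\<close>
  proof (intro exI[of _ "Suc s"] allI impI)
    fix p h D
    assume p: "Suc s \<le> p" "Factorial_Ring.prime p"
      and "h = reduce_mod p g \<and>
             \<one>\<^bsub>poly_ring (residue_ring (int p))\<^esub>
               gcdof\<^bsub>poly_ring (residue_ring (int p))\<^esub> h X\<^bsub>residue_ring (int p)\<^esub> \<and>
             Polynomials.degree h = s \<and>
             equally_likely_factor p s D"
    hence "prob_irreducible D s \<ge> 1 - real s / (real p - 1)"
      using s by (intro prob_irreducible_lower_bound) auto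
    moreover have "real s / (real p - 1) \<le> (real s + 1) / (real p - 1)"
      using p by (intro divide_right_mono) auto
    moreover have "(real s)\<^sup>2 / (real p - 1)\<^sup>2 \<ge> 0" by simp
    ultimately show "prob_irreducible D s
        \<ge> 1 - (real s + 1) / (real p - 1) - 1 * ((real s)\<^sup>2 / (real p - 1)\<^sup>2)"
      by linarith
  qed
qed simp

end
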